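(* Let $0\le k\le n-2$. An $n$-element poset $P$ has a $k$-untangled labeling if and only if $P$ has a lower order ideal of size $k+2$ that is not an antichain.
   Context: A labeling of a finite $n$-element poset $P$ is a bijection $L:P\to[n]$; a linear extension is a labeling with $L(x)\le L(y)$ whenever $x\le_P y$. A lower order ideal of $P$ is a subset $Q$ such that $x\in Q$ and $x'\le_P x$ imply $x'\in Q$. For a labeling $L$ and a non-maximal $x\in P$, the $L$-successor of $x$ is the element $y>_P x$ minimizing $L(y)$. The promotion chain of $L$ is $v_1<_P\cdots<_P v_m$, where $v_1=L^{-1}(1)$, $v_{i+1}$ is the $L$-successor of $v_i$ as long as $v_i$ is not maximal, and $v_m$ is maximal. Extended promotion is defined by $\partial(L)(x)=L(x)-1$ if $x$ is not in the promotion chain, $\partial(L)(v_i)=L(v_{i+1})-1$ for $1\le i\le m-1$, and $\partial(L)(v_m)=n$. A labeling $L$ of an $n$-element poset is $k$-untangled if $n\ge k+2$ and $\partial^{n-k-2}(L)$ is not a linear extension. *)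

theory Defs
  imports Main
begin

text \<open>
  A finite poset is a finite carrier \<open>P\<close> together with a relation \<open>r\<close> satisfying
  \<^term>\<open>partial_order_on P r\<close>, where \<^term>\<open>(x, y) \<in> r\<close> means \<open>x \<le>\<^sub>P y\<close>.
  Labelings are functions \<^typ>\<open>'a \<Rightarrow> nat\<close> of which only the values on \<open>P\<close> matter.
\<close>

definition labeling :: "'a set \<Rightarrow> ('a \<Rightarrow> nat) \<Rightarrow> bool" where
  "labeling P L \<longleftrightarrow> bij_betw L P {1..card P}"

definition linear_extension :: "'a set \<Rightarrow> 'a rel \<Rightarrow> ('a \<Rightarrow> nat) \<Rightarrow> bool" where
  "linear_extension P r L \<longleftrightarrow>
     labeling P L \<and> (\<forall>x\<in>P. \<forall>y\<in>P. (x, y) \<in> r \<longrightarrow> L x \<le> L y)"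

definition lower_order_ideal :: "'a set \<Rightarrow> 'a rel \<Rightarrow> 'a set \<Rightarrow> bool" where
  "lower_order_ideal P r Q \<longleftrightarrow>
     Q \<subseteq> P \<and> (\<forall>x\<in>Q. \<forall>x'\<in>P. (x', x) \<in> r \<longrightarrow> x' \<in> Q)"

definition antichain :: "'a rel \<Rightarrow> 'a set \<Rightarrow> bool" where
  "antichain r Q \<longleftrightarrow> (\<forall>x\<in>Q. \<forall>y\<in>Q. (x, y) \<in> r \<longrightarrow> x = y)"

definition maximal_element :: "'a set \<Rightarrow> 'a rel \<Rightarrow> 'a \<Rightarrow> bool" where
  "maximal_element P r x \<longleftrightarrow> x \<in> P \<and> \<not> (\<exists>y\<in>P. (x, y) \<in> r \<and> y \<noteq> x)"

text \<open>Meaningful only if \<open>x\<close> is not maximal; \<^term>\<open>aboveS r x\<close> is \<open>{y. y >\<^sub>P x}\<close>.\<close>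

definition successor :: "'a rel \<Rightarrow> ('a \<Rightarrow> nat) \<Rightarrow> 'a \<Rightarrow> 'a" where
  "successor r L x = arg_min_on L (aboveS r x)"

text \<open>
  The set \<open>{v\<^sub>1, \<dots>, v\<^sub>m}\<close> of elements of the promotion chain. The indices are not
  recorded: \<open>v\<^sub>m\<close> is the only maximal element in it, and \<open>v\<^sub>i\<^sub>+\<^sub>1\<close> is the successor of
  \<open>v\<^sub>i\<close>.
\<close>

inductive_set promotion_chain :: "'a set \<Rightarrow> 'a rel \<Rightarrow> ('a \<Rightarrow> nat) \<Rightarrow> 'a set"
  for P :: "'a set" and r :: "'a rel" and L :: "'a \<Rightarrow> nat" where
  first: "inv_into P L 1 \<in> promotion_chain P r L"
| step: "\<lbrakk>v \<in> promotion_chain P r L; \<not> maximal_element P r v\<rbrakk>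
    \<Longrightarrow> successor r L v \<in> promotion_chain P r L"

definition promotion :: "'a set \<Rightarrow> 'a rel \<Rightarrow> ('a \<Rightarrow> nat) \<Rightarrow> 'a \<Rightarrow> nat" where
  "promotion P r L x =
     (if x \<notin> promotion_chain P r L then L x - 1
      else if \<not> maximal_element P r x then L (successor r L x) - 1
      else card P)"

definition untangled :: "'a set \<Rightarrow> 'a rel \<Rightarrow> nat \<Rightarrow> ('a \<Rightarrow> nat) \<Rightarrow> bool" where
  "untangled P r k L \<longleftrightarrow>
     labeling P L \<and> k + 2 \<le> card P \<and>
     \<not> linear_extension P r ((promotion P r ^^ (card P - k - 2)) L)"

end

theory Submission
  imports Defs "HOL-Combinatorics.Transposition"
begin

text \<open>
  If the labels \<open>1, \<dots>, m + 1\<close> occupy a lower order ideal and \<open>m < n\<close>, then after one promotion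
  so do the labels \<open>1, \<dots>, m\<close>. Since the labels \<open>1, \<dots>, n\<close> always do, after \<open>n - k - 2\<close>
  promotions the labels \<open>1, \<dots>, m\<close> occupy a lower order ideal for every \<open>m \<ge> k + 2\<close>, so every
  remaining inversion lies in the one with \<open>m = k + 2\<close>. Conversely, given a lower order ideal \<open>Q\<close> of
  size \<open>k + 2\<close> with \<open>x < y\<close> in it, give \<open>Q\<close> the \<open>k + 2\<close> largest labels so that \<open>x\<close> and \<open>y\<close> are
  inverted. The first \<open>n - k - 2\<close> promotion chains start outside \<open>Q\<close> and so stay outside it;
  they merely lower all labels on \<open>Q\<close> by one, and the inversion survives.
\<close>

subsection \<open>Labelings\<close>

lemma labeling_if_surj:
  assumes "finite P" "{1..card P} \<subseteq> L ` P"
  shows "labeling P L"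
proof -
  have "L ` P = {1..card P}"
    using assms card_image_le[of P L] by (intro card_seteq[symmetric]) auto
  then show ?thesis
    using assms(1) by (simp add: labeling_def bij_betw_def eq_card_imp_inj_on)
qed

lemma labeling_inv_into:
  assumes "labeling P L" "i \<in> {1..card P}"
  shows "inv_into P L i \<in> P" "L (inv_into P L i) = i"
  using assms inv_into_into[of i L P] f_inv_into_f[of i L P]
  by (simp_all add: labeling_def bij_betw_def)

definition sublevel :: "'a set \<Rightarrow> ('a \<Rightarrow> 'b::ord) \<Rightarrow> 'b \<Rightarrow> 'a set" where
  "sublevel P L m = {x \<in> P. L x \<le> m}"

lemma card_sublevel:
  assumes "labeling P L" "m \<le> card P"
  shows "card (sublevel P L m) = m"
proof -
  have inj: "inj_on L P" and range: "L ` P = {1..card P}"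
    using assms(1) by (auto simp: labeling_def bij_betw_def)
  have "L ` sublevel P L m = L ` P \<inter> {..m}"
    by (auto simp: sublevel_def)
  also have "\<dots> = {1..m}"
    using assms(2) unfolding range by auto
  finally have "card (L ` sublevel P L m) = m"
    by simp
  moreover have "inj_on L (sublevel P L m)"
    using inj by (rule inj_on_subset) (simp add: sublevel_def)
  ultimately show ?thesis
    by (simp add: card_image)
qed

lemma sublevel_eq_carrier:
  assumes "labeling P L" "card P \<le> m"
  shows "sublevel P L m = P"
proof -
  have "L x \<le> m" if "x \<in> P" for x
    using assms that bij_betwE[of L P] by (fastforce simp: labeling_def)
  then show ?thesis
    by (auto simp: sublevel_def)
qed

lemma ex_bij_betw_inverting:
  fixes T :: "'b::linorder set"
  assumes "finite Q" "finite T" "card Q = card T" and xy: "x \<in> Q" "y \<in> Q" "x \<noteq> y"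
  obtains g where "bij_betw g Q T" "g y < g x"
proof -
  obtain g where bij_g: "bij_betw g Q T"
    using finite_same_card_bij assms by blast
  then have "g x \<noteq> g y"
    using xy by (auto simp: bij_betw_def dest: inj_onD)
  then consider "g y < g x" | "g x < g y"
    by fastforce
  then show ?thesis
  proof cases
    assume "g x < g y"
    then show ?thesis
      using that[of "g \<circ> transpose x y"] bij_g xy by (simp add: bij_betw_swap_iff)
  qed (use that bij_g in blast)
qed

lemma ex_labeling_inverting_top:
  assumes "finite P" "Q \<subseteq> P" and xy: "x \<in> Q" "y \<in> Q" "x \<noteq> y"
  obtains L where "labeling P L" "\<forall>z\<in>Q. card (P - Q) < L z" "L y < L x"
proof -
  define m where "m = card (P - Q)"
  have "finite Q"
    using finite_subset[OF assms(2,1)] .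
  then have card_P: "card P = m + card Q"
    using assms(1,2) by (simp add: m_def card_Diff_subset card_mono)
  then have "card Q = card {Suc m..card P}"
    by simp
  then obtain g where bij_g: "bij_betw g Q {Suc m..card P}" and inverted: "g y < g x"
    using ex_bij_betw_inverting[OF \<open>finite Q\<close> finite_atLeastAtMost _ xy] by metis
  have "finite (P - Q)" "card (P - Q) = card {1..m}"
    using assms(1) by (simp_all add: m_def)
  then obtain f where bij_f: "bij_betw f (P - Q) {1..m}"
    using finite_same_card_bij by blast
  define L where "L z = (if z \<in> Q then g z else f z)" for z
  have "bij_betw L (Q \<union> (P - Q)) ({Suc m..card P} \<union> {1..m})"
    unfolding L_def using bij_betw_disjoint_Un[OF bij_g bij_f] by auto
  moreover have "Q \<union> (P - Q) = P" "{Suc m..card P} \<union> {1..m} = {1..card P}"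
    using assms(2) card_P by auto
  ultimately have "labeling P L"
    by (simp add: labeling_def)
  moreover have "\<forall>z\<in>Q. m < L z"
    using bij_betwE[OF bij_g] by (simp add: L_def Suc_le_eq)
  moreover have "L y < L x"
    using inverted xy by (simp add: L_def)
  ultimately show ?thesis
    unfolding m_def by (rule that)
qed

lemma linear_extension_if_antichain_sublevel:
  assumes "labeling P L" "antichain r (sublevel P L b)"
    and ideal: "\<And>m. b \<le> m \<Longrightarrow> lower_order_ideal P r (sublevel P L m)"
  shows "linear_extension P r L"
  unfolding linear_extension_def
proof (intro conjI ballI impI)
  fix x y assume xy: "x \<in> P" "y \<in> P" "(x, y) \<in> r"
  have below: "L x \<le> m" if "b \<le> m" "L y \<le> m" for m
    using ideal[OF that(1)] xy that(2) by (auto simp: lower_order_ideal_def sublevel_def)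
  show "L x \<le> L y"
  proof (cases "b \<le> L y")
    case True
    then show ?thesis
      by (rule below) simp
  next
    case False
    then have "x \<in> sublevel P L b" "y \<in> sublevel P L b"
      using xy below[of b] by (auto simp: sublevel_def)
    then have "x = y"
      using assms(2) xy(3) by (auto simp: antichain_def)
    then show ?thesis
      by simp
  qed
qed (rule assms(1))

subsection \<open>Promotion chains\<close>

locale finite_poset =
  fixes P :: "'a set" and r :: "'a rel"
  assumes finite_carrier: "finite P" and partial_order: "partial_order_on P r"
begin

lemma less_eq_in_carrier:
  assumes "(x, y) \<in> r"
  shows "x \<in> P" "y \<in> P"
  using assms partial_order_onD(4)[OF partial_order] by auto

lemma aboveS_subset: "aboveS r x \<subseteq> P"
  using less_eq_in_carrier by (auto simp: aboveS_def)

lemma finite_aboveS: "finite (aboveS r x)"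
  using finite_subset[OF aboveS_subset finite_carrier] .

lemma maximal_element_iff_aboveS_empty:
  "x \<in> P \<Longrightarrow> maximal_element P r x \<longleftrightarrow> aboveS r x = {}"
  using aboveS_subset by (auto simp: maximal_element_def aboveS_def)

lemma successor_in_aboveS:
  "x \<in> P \<Longrightarrow> \<not> maximal_element P r x \<Longrightarrow> successor r L x \<in> aboveS r x"
  by (simp add: successor_def maximal_element_iff_aboveS_empty arg_min_if_finite finite_aboveS)

lemma successor_least: "y \<in> aboveS r x \<Longrightarrow> L (successor r L x) \<le> L y"
  unfolding successor_def by (rule arg_min_least[OF finite_aboveS]) auto

lemma promotion_chain_avoids_lower_order_ideal:
  assumes ideal: "lower_order_ideal P r Q" and start: "inv_into P L 1 \<in> P - Q"
  shows "promotion_chain P r L \<subseteq> P - Q"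
proof
  fix v assume "v \<in> promotion_chain P r L"
  then show "v \<in> P - Q"
  proof (induction rule: promotion_chain.induct)
    case first
    show ?case by (rule start)
  next
    case (step v)
    then have "successor r L v \<in> aboveS r v"
      by (intro successor_in_aboveS) auto
    with step show ?case
      using ideal aboveS_subset by (auto simp: lower_order_ideal_def aboveS_def)
  qed
qed

lemma promotion_chain_subset:
  assumes "inv_into P L 1 \<in> P"
  shows "promotion_chain P r L \<subseteq> P"
  using promotion_chain_avoids_lower_order_ideal[of "{}"] assms
  by (simp add: lower_order_ideal_def)

lemma ex_maximal_element_promotion_chain:
  assumes "inv_into P L 1 \<in> P"
  obtains v where "v \<in> promotion_chain P r L" "maximal_element P r v"
proof -
  have "finite r"
    using partial_order_onD(4)[OF partial_order] finite_carrier by (simp add: finite_subset)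
  then have "wf (r\<inverse> - Id)"
    using partial_order by (simp add: partial_order_on_well_order_on)
  then obtain v where v_in_chain: "v \<in> promotion_chain P r L"
    and top: "\<And>u. (u, v) \<in> r\<inverse> - Id \<Longrightarrow> u \<notin> promotion_chain P r L"
    using wfE_min[OF _ promotion_chain.first[of P L r]] by metis
  have "maximal_element P r v"
  proof (rule ccontr)
    assume nonmax: "\<not> maximal_element P r v"
    then have "successor r L v \<in> aboveS r v"
      using v_in_chain promotion_chain_subset[OF assms] by (intro successor_in_aboveS) auto
    then show False
      using top promotion_chain.step[OF v_in_chain nonmax] by (auto simp: aboveS_def)
  qed
  with v_in_chain show ?thesis by (rule that)
qed

subsection \<open>Promotion of labelings\<close>

text \<open>
  By finiteness it suffices that every label is attained: the label \<open>n\<close> at the maximal element of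
  the chain, and a label \<open>i < n\<close> at the element \<open>y\<close> with \<open>L y = i + 1\<close> if \<open>y\<close> is off the chain and
  at its predecessor in the chain otherwise.
\<close>

lemma labeling_promotion:
  assumes labeling: "labeling P L"
  shows "labeling P (promotion P r L)"
proof (rule labeling_if_surj[OF finite_carrier], rule subsetI)
  fix i assume i: "i \<in> {1..card P}"
  then have start: "inv_into P L 1 \<in> P" and label_start: "L (inv_into P L 1) = 1"
    using labeling_inv_into[OF labeling, of 1] by auto
  note chain_subset = promotion_chain_subset[OF start]
  show "i \<in> promotion P r L ` P"
  proof (cases "i = card P")
    case True
    obtain v where "v \<in> promotion_chain P r L" "maximal_element P r v"
      using ex_maximal_element_promotion_chain[OF start] .
    then show ?thesis
      using True chain_subset by (force simp: promotion_def)
  next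
    case False
    then obtain y where y: "y \<in> P" "L y = Suc i"
      using labeling_inv_into[OF labeling, of "Suc i"] i by auto
    show ?thesis
    proof (cases "y \<in> promotion_chain P r L")
      case True
      then show ?thesis
      proof cases
        case first
        then show ?thesis using y(2) label_start i by simp
      next
        case (step v)
        then have "promotion P r L v = i"
          using y(2) by (simp add: promotion_def)
        then show ?thesis using step chain_subset by blast
      qed
    next
      case False
      then have "promotion P r L y = i"
        using y(2) by (simp add: promotion_def)
      then show ?thesis using y(1) by blast
    qed
  qed
qed

lemma labeling_funpow_promotion:
  "labeling P L \<Longrightarrow> labeling P ((promotion P r ^^ j) L)"
  by (induction j) (auto intro: labeling_promotion)

lemma lower_order_ideal_sublevel_promotion:
  assumes ideal: "lower_order_ideal P r (sublevel P L (Suc m))" and m_less: "m < card P"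
  shows "lower_order_ideal P r (sublevel P (promotion P r L) m)"
proof -
  have down: "L x \<le> Suc m" if "(x, y) \<in> r" "L y \<le> Suc m" for x y
    using ideal that less_eq_in_carrier[OF that(1)]
    by (auto simp: lower_order_ideal_def sublevel_def)
  have "promotion P r L x \<le> m" if xy: "(x, y) \<in> r" and y: "promotion P r L y \<le> m" for x y
  proof (cases "x = y")
    case False
    then have above: "y \<in> aboveS r x"
      using xy by (simp add: aboveS_def)
    then have nonmax: "\<not> maximal_element P r x"
      using less_eq_in_carrier[OF xy] by (auto simp: maximal_element_iff_aboveS_empty)
    have "L y \<le> Suc m"
    proof (cases "y \<in> promotion_chain P r L")
      case True
      then have "\<not> maximal_element P r y" and "L (successor r L y) \<le> Suc m"
        using y m_less by (auto simp: promotion_def split: if_splits)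
      then show ?thesis
        using down successor_in_aboveS[of y] less_eq_in_carrier[OF xy] by (auto simp: aboveS_def)
    qed (use y in \<open>simp add: promotion_def\<close>)
    then have "L x \<le> Suc m" "L (successor r L x) \<le> Suc m"
      using down[OF xy] successor_least[OF above, of L] by auto
    then show ?thesis
      using nonmax by (simp add: promotion_def le_diff_conv)
  qed (use y in simp)
  then show ?thesis
    by (auto simp: lower_order_ideal_def sublevel_def)
qed

lemma lower_order_ideal_sublevel_funpow_promotion:
  assumes labeling: "labeling P L" and "card P - j \<le> m"
  shows "lower_order_ideal P r (sublevel P ((promotion P r ^^ j) L) m)"
  using assms(2)
proof (induction j arbitrary: m)
  case 0
  then show ?case
    using labeling by (simp add: sublevel_eq_carrier lower_order_ideal_def)
next
  case (Suc j)
  show ?case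
  proof (cases "m < card P")
    case True
    then show ?thesis
      using Suc by (simp add: lower_order_ideal_sublevel_promotion)
  next
    case False
    then show ?thesis
      using labeling_funpow_promotion[OF labeling]
      by (simp add: sublevel_eq_carrier lower_order_ideal_def del: funpow.simps)
  qed
qed

lemma promotion_on_lower_order_ideal:
  assumes "lower_order_ideal P r Q" "inv_into P L 1 \<in> P - Q" "x \<in> Q"
  shows "promotion P r L x = L x - 1"
  using promotion_chain_avoids_lower_order_ideal[OF assms(1,2)] assms(3)
  by (auto simp: promotion_def)

lemma funpow_promotion_on_lower_order_ideal:
  assumes labeling: "labeling P L" and ideal: "lower_order_ideal P r Q"
    and "\<forall>x\<in>Q. j < L x" "x \<in> Q"
  shows "(promotion P r ^^ j) L x = L x - j"
  using assms(3,4)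
proof (induction j arbitrary: x)
  case 0
  then show ?case by simp
next
  case (Suc j)
  define M where "M = (promotion P r ^^ j) L"
  have M_on_Q: "M z = L z - j" if "z \<in> Q" for z
    using Suc that by (simp add: M_def Suc_lessD)
  have "card P \<noteq> 0"
    using Suc.prems ideal finite_carrier by (auto simp: lower_order_ideal_def)
  then have "inv_into P M 1 \<in> P" "M (inv_into P M 1) = 1"
    using labeling_inv_into[OF labeling_funpow_promotion[OF labeling], of 1 j]
    by (auto simp: M_def)
  moreover have "M z \<noteq> 1" if "z \<in> Q" for z
    using M_on_Q[OF that] Suc.prems(1) that by fastforce
  ultimately have "inv_into P M 1 \<in> P - Q"
    by blast
  then show ?case
    using promotion_on_lower_order_ideal[OF ideal _ Suc.prems(2)] M_on_Q[OF Suc.prems(2)]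
    by (simp add: M_def)
qed

subsection \<open>Untangled labelings and lower order ideals\<close>

lemma ex_lower_order_ideal_if_untangled:
  assumes "untangled P r k L"
  obtains Q where "lower_order_ideal P r Q" "card Q = k + 2" "\<not> antichain r Q"
proof -
  define M where "M = (promotion P r ^^ (card P - k - 2)) L"
  have labeling_L: "labeling P L" and k_le: "k + 2 \<le> card P"
    and not_ext: "\<not> linear_extension P r M"
    using assms by (auto simp: untangled_def M_def)
  have labeling_M: "labeling P M"
    unfolding M_def by (rule labeling_funpow_promotion[OF labeling_L])
  have ideal: "lower_order_ideal P r (sublevel P M m)" if "k + 2 \<le> m" for m
    unfolding M_def using that k_le
    by (intro lower_order_ideal_sublevel_funpow_promotion[OF labeling_L]) simp
  show ?thesis
  proof (rule that)
    show "lower_order_ideal P r (sublevel P M (k + 2))"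
      by (rule ideal) simp
    show "card (sublevel P M (k + 2)) = k + 2"
      using labeling_M k_le by (rule card_sublevel)
    show "\<not> antichain r (sublevel P M (k + 2))"
      using linear_extension_if_antichain_sublevel[OF labeling_M _ ideal] not_ext by blast
  qed
qed

lemma ex_untangled_if_lower_order_ideal:
  assumes Q: "lower_order_ideal P r Q" "card Q = k + 2" "\<not> antichain r Q"
  obtains L where "untangled P r k L"
proof -
  let ?j = "card (P - Q)"
  have "Q \<subseteq> P"
    using Q(1) by (simp add: lower_order_ideal_def)
  then have card: "k + 2 \<le> card P" "?j = card P - k - 2"
    using Q(2) card_mono[OF finite_carrier, of Q] finite_subset[OF _ finite_carrier, of Q]
    by (simp_all add: card_Diff_subset)
  obtain x y where xy: "x \<in> Q" "y \<in> Q" "(x, y) \<in> r" "x \<noteq> y"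
    using Q(3) by (auto simp: antichain_def)
  obtain L where labeling: "labeling P L" and top: "\<forall>z\<in>Q. ?j < L z" and "L y < L x"
    using ex_labeling_inverting_top[OF finite_carrier \<open>Q \<subseteq> P\<close> xy(1,2,4)] .
  have "(promotion P r ^^ ?j) L z = L z - ?j" if "z \<in> Q" for z
    using labeling Q(1) top that by (rule funpow_promotion_on_lower_order_ideal)
  then have "(promotion P r ^^ ?j) L y < (promotion P r ^^ ?j) L x"
    using \<open>L y < L x\<close> top xy by (simp add: diff_less_mono less_imp_le)
  then have "\<not> linear_extension P r ((promotion P r ^^ ?j) L)"
    using xy \<open>Q \<subseteq> P\<close> by (force simp: linear_extension_def not_le)
  then show ?thesis
    using that labeling card by (simp add: untangled_def)
qed

end

theorem theorem2p10:
  fixes P :: "'a set" and r :: "'a rel" and n k :: nat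
  assumes "finite P" and "partial_order_on P r" and "card P = n" and "k + 2 \<le> n"
  shows "(\<exists>L. untangled P r k L) \<longleftrightarrow>
         (\<exists>Q. lower_order_ideal P r Q \<and> card Q = k + 2 \<and> \<not> antichain r Q)"
proof -
  interpret finite_poset P r
    using assms(1,2) by unfold_locales
  show ?thesis
  proof
    assume "\<exists>L. untangled P r k L"
    then obtain L where "untangled P r k L" ..
    then show "\<exists>Q. lower_order_ideal P r Q \<and> card Q = k + 2 \<and> \<not> antichain r Q"
      by (rule ex_lower_order_ideal_if_untangled) blast
  next
    assume "\<exists>Q. lower_order_ideal P r Q \<and> card Q = k + 2 \<and> \<not> antichain r Q"
    then obtain Q where "lower_order_ideal P r Q" "card Q = k + 2" "\<not> antichain r Q"
      by blast
    then show "\<exists>L. untangled P r k L"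
      by (rule ex_untangled_if_lower_order_ideal) blast
  qed
qed

end
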